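(* Let $(X,d)$ be a nonempty metric space and let $\mathfrak{C}=\mathfrak{C}_{d}$ be the large scale resemblance induced by $d$. Let $\mathcal{A}\in\mathfrak{N}_{\mathfrak{C}}$ be such that $\bigcap_{A\in\mathcal{A}}\overline{A}=\emptyset$. Then no bunch $\mathcal{C}$ in $(X,\mathfrak{N}_{\mathfrak{C}})$ satisfies $\mathcal{A}\subseteq\mathcal{C}$.
   Context: $\mathcal{P}(X)$ is the power set of $X$, and closures are taken in the metric topology of $X$. $d_H$ is the Hausdorff distance between subsets of $X$, with $d_H(\emptyset,\emptyset)=0$ and $d_H(\emptyset,A)=\infty$ for $A\ne\emptyset$. $\mathfrak{C}_d\subseteq\mathcal{P}(\mathcal{P}(X))$: $\mathcal{A}\in\mathfrak{C}_d$ iff there is $k>0$ with $d_H(A,B)\le k$ for all $A,B\in\mathcal{A}$. A set $B\subseteq X$ is bounded if $B=\emptyset$ or $\{B,\{x\}\}\in\mathfrak{C}_d$ for some $x\in X$ (equivalently, $B$ is bounded in the metric space). For $\mathcal{A},\mathcal{B}\subseteq\mathcal{P}(X)$, $\mathcal{B}\ll\mathcal{A}$ means that for each $A\in\mathcal{A}$ there is $B\in\mathcal{B}$ with $B\subseteq A$. The intersection of the empty family of subsets of $X$ is $X$. $\mathfrak{N}_{\mathfrak{C}}$ (a nearness structure on $X$): $\mathcal{A}\in\mathfrak{N}_{\mathfrak{C}}$ iff either $\bigcap_{A\in\mathcal{A}}\overline{A}\neq\emptyset$, or there is $\mathcal{B}\in\mathfrak{C}$ such that $\mathcal{B}$ contains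 no bounded subset of $X$ and $\mathcal{B}\ll\mathcal{A}$. A bunch in $(X,\mathfrak{N})$ is a nonempty $\mathcal{C}\subseteq\mathcal{P}(X)$ such that: (i) $\mathcal{C}\in\mathfrak{N}$; (ii) for all $A,B\subseteq X$, $A\cup B\in\mathcal{C}$ iff $A\in\mathcal{C}$ or $B\in\mathcal{C}$; (iii) if $\overline{A}\in\mathcal{C}$ then $A\in\mathcal{C}$. Here the closure is with respect to the topology induced by $\mathfrak{N}$, which for $\mathfrak{N}_{\mathfrak{C}}$ is the metric topology. *)

theory Defs
  imports "HOL-Analysis.Analysis"
begin

text \<open>
  The space X is a type of class \<open>metric_space\<close>; it is automatically nonempty, \<open>X = UNIV\<close>, and
  the intersection of the empty family is \<open>UNIV\<close>.
\<close>

text \<open>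
  The Hausdorff distance, valued in \<open>[0, \<infinity>]\<close>. Suprema over the empty set are \<open>0\<close> and infima over
  the empty set are \<open>\<infinity>\<close> in \<open>ennreal\<close>, which gives the usual conventions for the empty set.
\<close>

definition hausdorff_dist :: "'a::metric_space set \<Rightarrow> 'a set \<Rightarrow> ennreal" where
  "hausdorff_dist A B =
     max (SUP a\<in>A. INF b\<in>B. ennreal (dist a b)) (SUP b\<in>B. INF a\<in>A. ennreal (dist a b))"

lemma hausdorff_dist_empty_empty: "hausdorff_dist {} {} = 0"
  by (simp add: hausdorff_dist_def bot_ennreal)

lemma hausdorff_dist_empty: "A \<noteq> {} \<Longrightarrow> hausdorff_dist {} A = \<infinity>"
  by (simp add: hausdorff_dist_def)

definition metric_lsr :: "'a::metric_space set set set" where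
  "metric_lsr = {\<A>. \<exists>k::real. k > 0 \<and> (\<forall>A\<in>\<A>. \<forall>B\<in>\<A>. hausdorff_dist A B \<le> ennreal k)}"

definition lsr_bounded :: "'a set set set \<Rightarrow> 'a set \<Rightarrow> bool" where
  "lsr_bounded \<CC> B \<longleftrightarrow> B = {} \<or> (\<exists>x. {B, {x}} \<in> \<CC>)"

definition corefines :: "'a set set \<Rightarrow> 'a set set \<Rightarrow> bool"  (infix "\<lless>" 50) where
  "\<B> \<lless> \<A> \<longleftrightarrow> (\<forall>A\<in>\<A>. \<exists>B\<in>\<B>. B \<subseteq> A)"

definition lsr_nearness :: "'a::metric_space set set set \<Rightarrow> 'a set set set" where
  "lsr_nearness \<CC> =
     {\<A>. (\<Inter>A\<in>\<A>. closure A) \<noteq> {} \<or>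
          (\<exists>\<B>\<in>\<CC>. (\<forall>B\<in>\<B>. \<not> lsr_bounded \<CC> B) \<and> \<B> \<lless> \<A>)}"

text \<open>
  The closure operator of the topology induced by a nearness structure. For the nearness structure
  of a metric space it is the metric closure, see \<open>nearness_closure_metric\<close> below.
\<close>

definition nearness_closure :: "'a set set set \<Rightarrow> 'a set \<Rightarrow> 'a set" where
  "nearness_closure \<NN> A = {x. {{x}, A} \<in> \<NN>}"

definition bunch :: "'a set set set \<Rightarrow> 'a set set \<Rightarrow> bool" where
  "bunch \<NN> \<C> \<longleftrightarrow>
     \<C> \<noteq> {} \<and> \<C> \<in> \<NN> \<and>
     (\<forall>A B. A \<union> B \<in> \<C> \<longleftrightarrow> A \<in> \<C> \<or> B \<in> \<C>) \<and>
     (\<forall>A. nearness_closure \<NN> A \<in> \<C> \<longrightarrow> A \<in> \<C>)"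

lemma hausdorff_dist_singleton:
  assumes "B \<noteq> {}"
  shows "hausdorff_dist B {x} = (SUP b\<in>B. ennreal (dist b x))"
proof -
  obtain b where "b \<in> B" using assms by blast
  then have "(INF a\<in>B. ennreal (dist a x)) \<le> (SUP a\<in>B. ennreal (dist a x))"
    by (meson INF_lower SUP_upper order_trans)
  then show ?thesis by (simp add: hausdorff_dist_def max_absorb1)
qed

lemma hausdorff_dist_commute: "hausdorff_dist A B = hausdorff_dist B A"
  by (simp add: hausdorff_dist_def dist_commute max.commute)

lemma hausdorff_dist_self: "hausdorff_dist A A = 0"
proof -
  have "(INF b\<in>A. ennreal (dist a b)) = 0" "(INF b\<in>A. ennreal (dist b a)) = 0" if "a \<in> A" for a
    using INF_lower[OF that, of "\<lambda>b. ennreal (dist a b)"]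
          INF_lower[OF that, of "\<lambda>b. ennreal (dist b a)"] by auto
  then show ?thesis
    by (cases "A = {}") (simp_all add: hausdorff_dist_def bot_ennreal)
qed

lemma lsr_bounded_metric_lsr: "lsr_bounded metric_lsr B \<longleftrightarrow> bounded B"
proof (cases "B = {}")
  case True
  then show ?thesis by (simp add: lsr_bounded_def)
next
  case False
  have "{B, {x}} \<in> metric_lsr \<longleftrightarrow> (\<exists>k>0. \<forall>b\<in>B. dist x b \<le> k)" for x
    using False
    by (auto simp: metric_lsr_def hausdorff_dist_commute[of "{x}" B] hausdorff_dist_self
        hausdorff_dist_singleton SUP_le_iff dist_commute intro: less_imp_le
        dest!: ennreal_le_iff[THEN iffD1, rotated])
  moreover have "(\<exists>k>0. \<forall>b\<in>B. dist x b \<le> k) \<longleftrightarrow> (\<exists>k. \<forall>b\<in>B. dist x b \<le> k)" for x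
    by (meson gt_ex less_le_trans max.cobounded1 max.cobounded2 order_trans max_less_iff_conj
        less_max_iff_disj zero_less_one)
  ultimately show ?thesis
    using False by (simp add: lsr_bounded_def bounded_def)
qed

lemma nearness_closure_metric: "nearness_closure (lsr_nearness metric_lsr) A = closure A"
proof -
  have "bounded {x} \<and> (B \<subseteq> {x} \<longrightarrow> bounded B)" for x :: 'a and B
    by (auto intro: bounded_subset[of "{x}"])
  then show ?thesis
    by (auto simp: nearness_closure_def lsr_nearness_def corefines_def lsr_bounded_metric_lsr)
qed

end

theory Submission
  imports Defs
begin

text \<open>
  A bunch \<open>\<C>\<close> containing \<open>\<A>\<close> also has no adherent point, so it is corefined by a family of unbounded
  sets at mutual Hausdorff distance at most \<open>k\<close>. Fix a member \<open>B\<close> of that family: every member of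
  \<open>\<C>\<close> meets every ball of radius \<open>k + 1\<close> centred in \<open>B\<close>. If \<open>b, c \<in> B\<close> are far apart, then neither
  the ball around \<open>b\<close> nor its complement can belong to \<open>\<C>\<close>, although their union does.
\<close>

text \<open>The infimum over \<open>B\<close> need not be attained, hence the strictly larger radius
  \<open>r\<close>.\<close>

lemma hausdorff_dist_le_imp_dist_less:
  assumes "hausdorff_dist A B \<le> ennreal k" "0 \<le> k" "k < r" "a \<in> A"
  shows "\<exists>b\<in>B. dist a b < r"
proof -
  have "(INF b\<in>B. ennreal (dist a b)) \<le> ennreal k"
    using assms(1,4) by (simp add: hausdorff_dist_def SUP_le_iff)
  also have "\<dots> < ennreal r"
    using assms(2,3) by (simp add: ennreal_less_iff)
  finally show ?thesis
    by (auto simp: INF_less_iff ennreal_less_iff)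
qed

lemma unbounded_obtain_dist_greater:
  assumes "\<not> bounded B"
  obtains b c where "b \<in> B" "c \<in> B" "dist b c > r"
  using assms by (metis bounded_empty bounded_def equals0I not_le)

text \<open>Any member of \<open>\<C>\<close> united with \<open>UNIV\<close> gives
  \<open>UNIV\<close>.\<close>

lemma bunch_UNIV: "bunch \<NN> \<C> \<Longrightarrow> UNIV \<in> \<C>"
  unfolding bunch_def by (metis ex_in_conv sup_top_right)

theorem proposition4p14:
  fixes \<A> :: "'a::metric_space set set"
  assumes "\<A> \<in> lsr_nearness metric_lsr"
    and "(\<Inter>A\<in>\<A>. closure A) = {}"
  shows "\<not> (\<exists>\<C>. bunch (lsr_nearness metric_lsr) \<C> \<and> \<A> \<subseteq> \<C>)"
proof
  assume "\<exists>\<C>. bunch (lsr_nearness metric_lsr) \<C> \<and> \<A> \<subseteq> \<C>"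
  then obtain \<C> where \<C>: "bunch (lsr_nearness metric_lsr) \<C>" and "\<A> \<subseteq> \<C>" by blast
  then have "(\<Inter>A\<in>\<C>. closure A) = {}" using assms(2) by blast
  moreover have "\<C> \<in> lsr_nearness metric_lsr" using \<C> by (simp add: bunch_def)
  ultimately obtain \<B> where \<B>: "\<B> \<in> metric_lsr" "\<And>B. B \<in> \<B> \<Longrightarrow> \<not> bounded B" "\<B> \<lless> \<C>"
    by (auto simp: lsr_nearness_def lsr_bounded_metric_lsr)
  obtain k :: real where "k > 0" and k: "\<And>A B. A \<in> \<B> \<Longrightarrow> B \<in> \<B> \<Longrightarrow> hausdorff_dist A B \<le> ennreal k"
    using \<B>(1) by (auto simp: metric_lsr_def)
  \<comment> \<open>\<open>\<B>\<close> is nonempty because some member of it must lie inside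
    \<open>UNIV\<close>.\<close>
  obtain B where "B \<in> \<B>"
    using bunch_UNIV[OF \<C>] \<B>(3) by (auto simp: corefines_def)
  have near: "\<exists>a\<in>A. dist b a < k + 1" if "A \<in> \<C>" "b \<in> B" for A b
  proof -
    obtain B' where "B' \<in> \<B>" "B' \<subseteq> A" using \<B>(3) \<open>A \<in> \<C>\<close> by (auto simp: corefines_def)
    then show ?thesis
      using hausdorff_dist_le_imp_dist_less[OF k[OF \<open>B \<in> \<B>\<close>], of B' "k + 1" b] \<open>k > 0\<close> \<open>b \<in> B\<close>
      by auto
  qed
  \<comment> \<open>Twice the radius keeps the balls around \<open>b\<close> and \<open>c\<close>
    disjoint.\<close>
  obtain b c where bc: "b \<in> B" "c \<in> B" "dist b c > (k + 1) + (k + 1)"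
    using unbounded_obtain_dist_greater[OF \<B>(2)[OF \<open>B \<in> \<B>\<close>]] .
  have "ball b (k + 1) \<notin> \<C>"
  proof
    assume "ball b (k + 1) \<in> \<C>"
    then obtain a where "dist b a < k + 1" "dist c a < k + 1" using near bc(2) by force
    then show False
      using bc(3) dist_triangle2[of b c a] by argo
  qed
  \<comment> \<open>At the centre \<open>b\<close>, \<open>near\<close> would put a point of the
    complement inside the ball.\<close>
  moreover have "- ball b (k + 1) \<notin> \<C>"
    using near[OF _ bc(1)] by force
  moreover have "ball b (k + 1) \<union> - ball b (k + 1) \<in> \<C>"
    using bunch_UNIV[OF \<C>] by simp
  ultimately show False
    using \<C> unfolding bunch_def by blast
qed

end
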